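(* Let $C\subset\mathbb{R}^n$ be a closed strictly convex cone of dimension $n$ with apex at the origin, and let $\Gamma_1,\ldots,\Gamma_n$ be cobounded $C$-convex regions. Then the function $$P(\lambda_1,\ldots,\lambda_n)=\operatorname{covol}(\lambda_1\Gamma_1+\cdots+\lambda_n\Gamma_n),\qquad \lambda_1,\ldots,\lambda_n>0,$$ is a homogeneous polynomial of degree $n$ in the $\lambda_i$.
   Context: A cone is strictly convex if it is convex and contains no line through the origin. A subset $\Gamma\subset C$ is a $C$-convex region if it is closed and convex and $x+y\in\Gamma$ for all $x\in\Gamma$, $y\in C$. It is cobounded if $C\setminus\Gamma$ is bounded, and then $\operatorname{covol}(\Gamma)$ is the volume of $C\setminus\Gamma$. Sums are Minkowski sums $\lambda_1\Gamma_1+\lambda_2\Gamma_2=\{\lambda_1x_1+\lambda_2x_2: x_i\in\Gamma_i\}$. *)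

theory Defs
  imports "HOL-Analysis.Analysis"
begin

definition strictly_convex_cone :: "'a::real_vector set \<Rightarrow> bool" where
  "strictly_convex_cone C \<longleftrightarrow> cone C \<and> convex C \<and> (\<forall>x. x \<in> C \<and> - x \<in> C \<longrightarrow> x = 0)"

definition C_convex_region :: "'a::real_normed_vector set \<Rightarrow> 'a set \<Rightarrow> bool" where
  "C_convex_region C \<Gamma> \<longleftrightarrow> \<Gamma> \<subseteq> C \<and> closed \<Gamma> \<and> convex \<Gamma> \<and> (\<forall>x\<in>\<Gamma>. \<forall>y\<in>C. x + y \<in> \<Gamma>)"

definition cobounded :: "'a::real_normed_vector set \<Rightarrow> 'a set \<Rightarrow> bool" where
  "cobounded C \<Gamma> \<longleftrightarrow> bounded (C - \<Gamma>)"

definition covol :: "'a::euclidean_space set \<Rightarrow> 'a set \<Rightarrow> real" where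
  "covol C \<Gamma> = measure lebesgue (C - \<Gamma>)"

definition minkowski_comb :: "('i::finite \<Rightarrow> real) \<Rightarrow> ('i \<Rightarrow> 'a::real_vector set) \<Rightarrow> 'a set" where
  "minkowski_comb l \<Gamma> = {(\<Sum>i\<in>UNIV. l i *\<^sub>R x i) | x. \<forall>i. x i \<in> \<Gamma> i}"

end

theory Submission
  imports Defs
begin

text \<open>Choose a linear functional that is positive on \<open>C - {0}\<close>. Truncating every \<open>\<Gamma> i\<close> at a common
  high level \<open>s\<close> of this functional gives convex bodies \<open>K i\<close>, and the truncation of \<open>\<Sum> l i \<Gamma> i\<close> at
  level \<open>s \<Sum> l i\<close> equals \<open>\<Sum> l i K i\<close>. The covolume is therefore the volume of a truncated cone,
  which is a constant times \<open>(\<Sum> l i)^n\<close>, minus the volume of \<open>\<Sum> l i K i\<close>.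

  That the latter is a homogeneous polynomial is Minkowski's theorem. It is proved here by Gromov's
  argument: \<open>\<phi> x = ln (\<integral> w y * exp (x \<bullet> y) dy)\<close>, with a continuous weight \<open>w\<close> positive exactly on the
  interior of \<open>K\<close>, is strictly convex, and its gradient maps the whole space into \<open>K\<close>, covering the
  interior. The gradient of \<open>\<Sum> l i \<phi> i\<close> is then injective with image \<open>\<Sum> l i K i\<close> up to
  a null set, so the volume is the integral of \<open>det (\<Sum> l i H i)\<close>, where \<open>H i\<close> is the Hessian of
  \<open>\<phi> i\<close>, and the integrand is a form of degree \<open>n\<close> in \<open>l\<close> at every point.\<close>

section \<open>Homogeneous forms\<close>

text \<open>The identity is required for every real \<open>l\<close>, not only for positive ones, so
  that closure under sums and products is pure algebra; positivity enters only where volumes are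
  compared with a form.\<close>

definition homogeneous_form :: "nat \<Rightarrow> (('i::finite \<Rightarrow> real) \<Rightarrow> real) \<Rightarrow> bool" where
  "homogeneous_form N f \<longleftrightarrow> (\<exists>c. \<forall>l. f l =
     (\<Sum>\<alpha>\<in>{\<alpha>. (\<Sum>i\<in>UNIV. \<alpha> i) = N}. c \<alpha> * (\<Prod>i\<in>UNIV. l i ^ \<alpha> i)))"

lemma finite_exponents: "finite {\<alpha>::'i::finite \<Rightarrow> nat. (\<Sum>i\<in>UNIV. \<alpha> i) = N}"
proof (rule finite_subset)
  show "{\<alpha>::'i \<Rightarrow> nat. (\<Sum>i\<in>UNIV. \<alpha> i) = N} \<subseteq> UNIV \<rightarrow>\<^sub>E {..N}"
    by (auto simp: PiE_def Pi_def intro: member_le_sum)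
  show "finite ((UNIV::'i set) \<rightarrow>\<^sub>E {..N})"
    by (intro finite_PiE) auto
qed

lemma homogeneous_form_monomial:
  assumes "(\<Sum>i\<in>UNIV. \<beta> i) = N"
  shows "homogeneous_form N (\<lambda>l. a * (\<Prod>i\<in>UNIV. l i ^ \<beta> i))"
  unfolding homogeneous_form_def
proof (intro exI allI)
  fix l :: "'a \<Rightarrow> real"
  show "a * (\<Prod>i\<in>UNIV. l i ^ \<beta> i) =
      (\<Sum>\<alpha>\<in>{\<alpha>. (\<Sum>i\<in>UNIV. \<alpha> i) = N}. (if \<alpha> = \<beta> then a else 0) * (\<Prod>i\<in>UNIV. l i ^ \<alpha> i))"
    using assms by (simp add: if_distrib[of "\<lambda>x. x * _"] finite_exponents cong: if_cong)
qed

lemma homogeneous_form_zero: "homogeneous_form N (\<lambda>l. 0)"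
  unfolding homogeneous_form_def by (rule exI[of _ "\<lambda>_. 0"]) simp

lemma homogeneous_form_add:
  assumes "homogeneous_form N f" "homogeneous_form N g"
  shows "homogeneous_form N (\<lambda>l. f l + g l)"
proof -
  obtain c d where 
    "\<And>l. f l = (\<Sum>\<alpha>\<in>{\<alpha>. (\<Sum>i\<in>UNIV. \<alpha> i) = N}. c \<alpha> * (\<Prod>i\<in>UNIV. l i ^ \<alpha> i))"
    "\<And>l. g l = (\<Sum>\<alpha>\<in>{\<alpha>. (\<Sum>i\<in>UNIV. \<alpha> i) = N}. d \<alpha> * (\<Prod>i\<in>UNIV. l i ^ \<alpha> i))"
    using assms unfolding homogeneous_form_def by blast
  then show ?thesis
    unfolding homogeneous_form_def
    by (intro exI[of _ "\<lambda>\<alpha>. c \<alpha> + d \<alpha>"]) (simp add: sum.distrib algebra_simps)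
qed

lemma homogeneous_form_sum:
  assumes "\<And>x. x \<in> A \<Longrightarrow> homogeneous_form N (f x)"
  shows "homogeneous_form N (\<lambda>l. \<Sum>x\<in>A. f x l)"
  using assms
  by (induction A rule: infinite_finite_induct)
     (auto intro!: homogeneous_form_zero homogeneous_form_add)

lemma homogeneous_form_mult:
  assumes "homogeneous_form N f" "homogeneous_form M g"
  shows "homogeneous_form (N + M) (\<lambda>l. f l * g l)"
proof -
  obtain c d where
    c: "\<And>l. f l = (\<Sum>\<alpha>\<in>{\<alpha>. (\<Sum>i\<in>UNIV. \<alpha> i) = N}. c \<alpha> * (\<Prod>i\<in>UNIV. l i ^ \<alpha> i))" and
    d: "\<And>l. g l = (\<Sum>\<alpha>\<in>{\<alpha>. (\<Sum>i\<in>UNIV. \<alpha> i) = M}. d \<alpha> * (\<Prod>i\<in>UNIV. l i ^ \<alpha> i))"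
    using assms unfolding homogeneous_form_def by blast
  have "f l * g l = (\<Sum>\<alpha>\<in>{\<alpha>. (\<Sum>i\<in>UNIV. \<alpha> i) = N}. \<Sum>\<beta>\<in>{\<beta>. (\<Sum>i\<in>UNIV. \<beta> i) = M}.
      (c \<alpha> * d \<beta>) * (\<Prod>i\<in>UNIV. l i ^ (\<alpha> i + \<beta> i)))" for l
    unfolding c d sum_product by (simp add: power_add prod.distrib mult_ac)
  then have eq: "(\<lambda>l. f l * g l) = (\<lambda>l. \<Sum>\<alpha>\<in>{\<alpha>. (\<Sum>i\<in>UNIV. \<alpha> i) = N}. \<Sum>\<beta>\<in>{\<beta>. (\<Sum>i\<in>UNIV. \<beta> i) = M}.
      (c \<alpha> * d \<beta>) * (\<Prod>i\<in>UNIV. l i ^ (\<alpha> i + \<beta> i)))"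
    by blast
  show ?thesis
    unfolding eq by (intro homogeneous_form_sum homogeneous_form_monomial) (auto simp: sum.distrib)
qed

lemma homogeneous_form_const: "homogeneous_form 0 (\<lambda>l. a)"
  using homogeneous_form_monomial[of "\<lambda>_. 0" 0 a] by simp

lemma homogeneous_form_cmult:
  "homogeneous_form N f \<Longrightarrow> homogeneous_form N (\<lambda>l. a * f l)"
  using homogeneous_form_mult[OF homogeneous_form_const] by fastforce

lemma homogeneous_form_diff:
  assumes "homogeneous_form N f" "homogeneous_form N g"
  shows "homogeneous_form N (\<lambda>l. f l - g l)"
  using homogeneous_form_add[OF assms(1) homogeneous_form_cmult[OF assms(2), of "- 1"]] by simp

lemma homogeneous_form_var: "homogeneous_form 1 (\<lambda>l. l (i::'i::finite))"
proof -
  have 1: "(\<Sum>j\<in>UNIV. if j = i then 1 else 0::nat) = 1" by simp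
  have 2: "(\<Prod>j\<in>UNIV. l j ^ (if j = i then 1 else 0)) = l i" for l :: "'i \<Rightarrow> real"
    by (simp add: if_distrib[of "\<lambda>n. _ ^ n"] cong: if_cong)
  show ?thesis using homogeneous_form_monomial[OF 1, of 1] unfolding 2 by simp
qed

lemma homogeneous_form_linear: "homogeneous_form 1 (\<lambda>l. \<Sum>i\<in>UNIV. l i * a i)"
  unfolding mult.commute[of _ "a _"]
  by (intro homogeneous_form_sum homogeneous_form_cmult homogeneous_form_var)

lemma homogeneous_form_prod:
  assumes "finite A" "\<And>x. x \<in> A \<Longrightarrow> homogeneous_form 1 (f x)"
  shows "homogeneous_form (card A) (\<lambda>l. \<Prod>x\<in>A. f x l)"
  using assms
proof (induction A rule: finite_induct)
  case empty
  then show ?case by (simp add: homogeneous_form_const)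
next
  case (insert x A)
  then show ?case
    using homogeneous_form_mult[of 1 "f x" "card A" "\<lambda>l. \<Prod>x\<in>A. f x l"] by simp
qed

lemma homogeneous_form_power:
  assumes "homogeneous_form 1 f"
  shows "homogeneous_form n (\<lambda>l. f l ^ n)"
  using homogeneous_form_prod[of "{..<n}" "\<lambda>_. f"] assms by simp

text \<open>In the Leibniz expansion each permutation contributes a sign times a product of
  \<open>CARD('m)\<close> matrix entries, and every entry is linear in \<open>l\<close>.\<close>

lemma homogeneous_form_det:
  fixes H :: "'i::finite \<Rightarrow> real^'m^'m"
  shows "homogeneous_form CARD('m) (\<lambda>l. det (\<Sum>i\<in>UNIV. l i *\<^sub>R H i))"
  unfolding det_def
  by (intro homogeneous_form_sum homogeneous_form_cmult homogeneous_form_prod)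
     (auto simp del: One_nat_def intro: homogeneous_form_linear)

section \<open>Integrals of families of homogeneous forms\<close>

text \<open>Doubling the variable \<open>l i\<close> multiplies each monomial by \<open>2 ^ \<alpha> i\<close>, so
  \<open>P (l(i := 2 * l i)) - 2 ^ \<beta> i * P l\<close> no longer contains the exponent \<open>\<beta>\<close>.\<close>

lemma coefficient_integrable:
  fixes a :: "('i::finite \<Rightarrow> nat) \<Rightarrow> 'b::euclidean_space \<Rightarrow> real"
  assumes "finite A" "\<alpha> \<in> A"
    and "\<And>l. (\<And>i. l i > 0) \<Longrightarrow>
      (\<lambda>x. \<Sum>\<gamma>\<in>A. a \<gamma> x * (\<Prod>i\<in>UNIV. l i ^ \<gamma> i)) integrable_on S"
  shows "a \<alpha> integrable_on S"
  using assms
proof (induction "card A" arbitrary: A a)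
  case 0
  then show ?case by auto
next
  case (Suc n)
  show ?case
  proof (cases "A = {\<alpha>}")
    case True
    \<comment> \<open>At \<open>l = 1\<close> every monomial is 1, so the assumed integrable
      function is the remaining coefficient itself.\<close>
    then show ?thesis using Suc.prems(3)[of "\<lambda>_. 1"] by (simp add: eta_contract_eq)
  next
    case False
    then obtain \<beta> where \<beta>: "\<beta> \<in> A" "\<beta> \<noteq> \<alpha>" using Suc.prems by blast
    then obtain i where i: "\<beta> i \<noteq> \<alpha> i" by blast
    define a' where "a' \<gamma> x = (2 ^ \<gamma> i - 2 ^ \<beta> i) * a \<gamma> x" for \<gamma> x
    have "a' \<alpha> integrable_on S"
    proof (rule Suc.hyps(1))
      fix l :: "'i \<Rightarrow> real" assume l: "\<And>i. l i > 0"
      let ?m = "\<lambda>\<gamma>. \<Prod>j\<in>UNIV. l j ^ \<gamma> j"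
      have m: "(\<Prod>j\<in>UNIV. (l(i := 2 * l i)) j ^ \<gamma> j) = 2 ^ \<gamma> i * ?m \<gamma>" for \<gamma> :: "'i \<Rightarrow> nat"
      proof -
        have "(\<Prod>j\<in>UNIV. (l(i := 2 * l i)) j ^ \<gamma> j) =
            (\<Prod>j\<in>UNIV. (if j = i then 2 ^ \<gamma> i else 1) * l j ^ \<gamma> j)"
          by (intro prod.cong) (auto simp: power_mult_distrib)
        then show ?thesis by (simp add: prod.distrib)
      qed
      have "(\<lambda>x. (\<Sum>\<gamma>\<in>A. a \<gamma> x * (\<Prod>j\<in>UNIV. (l(i := 2 * l i)) j ^ \<gamma> j))
            - 2 ^ \<beta> i * (\<Sum>\<gamma>\<in>A. a \<gamma> x * ?m \<gamma>)) integrable_on S"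
        by (intro integrable_diff integrable_on_mult_right Suc.prems(3)) (auto simp: l)
      \<comment> \<open>The term at \<open>\<beta>\<close> carries the factor
        \<open>2 ^ \<beta> i - 2 ^ \<beta> i = 0\<close> and drops out.\<close>
      moreover have "(\<Sum>\<gamma>\<in>A. a \<gamma> x * (\<Prod>j\<in>UNIV. (l(i := 2 * l i)) j ^ \<gamma> j))
            - 2 ^ \<beta> i * (\<Sum>\<gamma>\<in>A. a \<gamma> x * ?m \<gamma>) = (\<Sum>\<gamma>\<in>A - {\<beta>}. a' \<gamma> x * ?m \<gamma>)" for x
        unfolding m sum_distrib_left sum_subtractf[symmetric] a'_def
        by (subst sum.remove[OF Suc.prems(1) \<beta>(1)]) (simp add: algebra_simps)
      ultimately show "(\<lambda>x. \<Sum>\<gamma>\<in>A - {\<beta>}. a' \<gamma> x * ?m \<gamma>) integrable_on S"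
        by simp
    qed (use Suc \<beta> in auto)
    moreover have "(2::real) ^ \<alpha> i - 2 ^ \<beta> i \<noteq> 0" using i by simp
    ultimately show ?thesis
      using integrable_on_mult_right[of "a' \<alpha>" S "1 / (2 ^ \<alpha> i - 2 ^ \<beta> i)"]
      by (simp add: a'_def eta_contract_eq)
  qed
qed

text \<open>Integration acts coefficient by coefficient. Only the whole form is known to be
  integrable, and only for positive \<open>l\<close>; \<open>coefficient_integrable\<close> recovers
  the individual coefficients from this.\<close>

lemma integral_homogeneous_form:
  fixes P :: "'b::euclidean_space \<Rightarrow> ('i::finite \<Rightarrow> real) \<Rightarrow> real"
  assumes P: "\<And>x. homogeneous_form N (P x)"
    and int: "\<And>l. (\<And>i. l i > 0) \<Longrightarrow> (\<lambda>x. P x l) integrable_on S"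
  obtains V where "homogeneous_form N V"
    and "\<And>l. (\<And>i. l i > 0) \<Longrightarrow> integral S (\<lambda>x. P x l) = V l"
proof -
  let ?E = "{\<alpha>::'i \<Rightarrow> nat. (\<Sum>i\<in>UNIV. \<alpha> i) = N}"
  obtain c where c: "\<And>x l. P x l = (\<Sum>\<alpha>\<in>?E. c x \<alpha> * (\<Prod>i\<in>UNIV. l i ^ \<alpha> i))"
    using P unfolding homogeneous_form_def by metis
  have ci: "(\<lambda>x. c x \<alpha>) integrable_on S" if "\<alpha> \<in> ?E" for \<alpha>
    by (rule coefficient_integrable[OF finite_exponents that]) (use int in \<open>simp add: c\<close>)
  show thesis
  proof
    show "homogeneous_form N (\<lambda>l. \<Sum>\<alpha>\<in>?E. integral S (\<lambda>x. c x \<alpha>) * (\<Prod>i\<in>UNIV. l i ^ \<alpha> i))"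
      by (intro homogeneous_form_sum homogeneous_form_monomial) simp
    show "integral S (\<lambda>x. P x l) = (\<Sum>\<alpha>\<in>?E. integral S (\<lambda>x. c x \<alpha>) * (\<Prod>i\<in>UNIV. l i ^ \<alpha> i))" for l
      unfolding c by (subst integral_sum) (auto simp: finite_exponents intro!: integrable_on_mult_left ci)
  qed
qed

section \<open>The logarithmic Laplace transform of a convex body\<close>

text \<open>Differentiation under the integral sign. Letting \<open>g\<close> be vector valued
  covers both the normalising integral \<open>Z\<close> and the first moment \<open>N\<close>
  below.\<close>

lemma exp_integral_has_derivative:
  fixes g :: "'a::euclidean_space \<Rightarrow> 'b::euclidean_space"
  assumes g: "continuous_on UNIV g"
  shows "((\<lambda>x. integral (cbox a b) (\<lambda>y. exp (x \<bullet> y) *\<^sub>R g y)) has_derivative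
    (\<lambda>h. integral (cbox a b) (\<lambda>y. (exp (x \<bullet> y) * (h \<bullet> y)) *\<^sub>R g y))) (at x)"
proof -
  define D where "D x y = exp (x \<bullet> y) *\<^sub>R (blinfun_scaleR_left (g y) o\<^sub>L blinfun_inner_left y)" for x y :: 'a
  have D: "blinfun_apply (D x y) h = (exp (x \<bullet> y) * (h \<bullet> y)) *\<^sub>R g y" for x y h
    by (simp add: D_def blinfun.bilinear_simps inner_commute)
  have g': "continuous_on S g" for S using g continuous_on_subset by blast
  have g'': "continuous_on S (\<lambda>x. g (f x))" if "continuous_on S f" for S f
    using continuous_on_compose2[OF g that] by simp
  have cont: "continuous_on S (\<lambda>(x, y). D x y)" for S
    unfolding D_def split_def by (intro continuous_intros g'')
  have contD: "continuous_on S (D x)" for S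
    unfolding D_def by (intro continuous_intros g'')
  have "((\<lambda>x. integral (cbox a b) (\<lambda>y. exp (x \<bullet> y) *\<^sub>R g y)) has_derivative
      integral (cbox a b) (D x)) (at x within UNIV)"
  proof (rule leibniz_rule)
    show "((\<lambda>x. exp (x \<bullet> y) *\<^sub>R g y) has_derivative blinfun_apply (D x y)) (at x within UNIV)" for x y
      by (rule derivative_eq_intros refl | simp add: D fun_eq_iff)+
    show "(\<lambda>y. exp (x \<bullet> y) *\<^sub>R g y) integrable_on cbox a b" for x
      by (intro integrable_continuous continuous_intros g')
  qed (auto intro: cont)
  moreover have "blinfun_apply (integral (cbox a b) (D x)) =
      (\<lambda>h. integral (cbox a b) (\<lambda>y. (exp (x \<bullet> y) * (h \<bullet> y)) *\<^sub>R g y))"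
    using integral_linear[OF integrable_continuous[OF contD] bounded_linear_apply_blinfun, of a b]
    by (simp add: o_def D fun_eq_iff)
  ultimately show ?thesis by simp
qed

lemma integral_inner_right:
  assumes "f integrable_on S"
  shows "integral S (\<lambda>y. u \<bullet> f y) = u \<bullet> integral S f"
  using integral_linear[OF assms bounded_linear_inner_right[of u]] by (simp add: o_def)

lemma integral_continuous_cbox_pos:
  fixes f :: "'a::euclidean_space \<Rightarrow> real"
  assumes "continuous_on (cbox a b) f" "\<And>y. y \<in> cbox a b \<Longrightarrow> 0 \<le> f y"
    and "y \<in> box a b" "f y > 0"
  shows "integral (cbox a b) f > 0"
proof -
  have int: "f integrable_on cbox a b" using assms(1) by (rule integrable_continuous)
  have "integral (cbox a b) f \<noteq> 0"
    using has_integral_0_cbox_imp_0[of a b f y] int assms box_subset_cbox[of a b]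
    by (metis empty_iff integrable_integral less_irrefl subsetD)
  moreover have "integral (cbox a b) f \<ge> 0" using int assms(2) by (rule integral_nonneg)
  ultimately show ?thesis by linarith
qed

text \<open>Consider the probability density proportional to
  \<open>exp (x \<bullet> y) * w y\<close> in \<open>y\<close>. Then \<open>\<phi> = ln Z\<close>
  has the mean \<open>G x\<close> as gradient and the covariance \<open>H x\<close> as Hessian. The
  mean of a density supported in the convex set \<open>K\<close> lies in \<open>K\<close>, and the
  covariance is definite because the mass is not confined to a hyperplane. The last property makes
  \<open>\<phi> x - p \<bullet> x\<close> coercive, so that it has a minimum.\<close>

lemma convex_body_potential:
  fixes K :: "(real^'m) set"
  assumes "compact K" "convex K" "interior K \<noteq> {}"
  obtains \<phi> :: "real^'m \<Rightarrow> real" and G :: "real^'m \<Rightarrow> real^'m" and H :: "real^'m \<Rightarrow> real^'m^'m" where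
    "\<And>x. (\<phi> has_derivative (\<lambda>h. G x \<bullet> h)) (at x)"
    "\<And>x. (G has_derivative (\<lambda>h. H x *v h)) (at x)"
    "\<And>x h. h \<noteq> 0 \<Longrightarrow> 0 < h \<bullet> (H x *v h)"
    "\<And>x. G x \<in> K"
    "\<And>p. p \<in> interior K \<Longrightarrow> \<exists>c>0. \<exists>d. \<forall>x. c * norm x - d \<le> \<phi> x - p \<bullet> x"
proof -
  obtain b where "K \<subseteq> cbox (- b) b"
    using bounded_subset_cbox_symmetric compact_imp_bounded[OF assms(1)] by blast
  then obtain a where Kab: "K \<subseteq> cbox a b" by blast
  then have intK: "interior K \<subseteq> box a b"
    using interior_mono interior_cbox by blast
  \<comment> \<open>This weight is continuous on the whole space and zero off \<open>K\<close>, so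
    integrals over the box can replace integrals over \<open>K\<close>.\<close>
  define w where "w y = infdist y (- K)" for y
  \<comment> \<open>\<open>infdist\<close> to the empty set is 0 by convention, which would destroy
    positivity of \<open>w\<close>.\<close>
  have nK: "- K \<noteq> {}"
    using assms(1) compact_imp_bounded not_bounded_UNIV by (metis Compl_empty_eq double_complement)
  have w0: "w y \<ge> 0" for y by (simp add: w_def infdist_nonneg)
  have w_out: "w y = 0" if "y \<notin> K" for y using that by (simp add: w_def)
  have w_pos: "w y > 0" if "y \<in> interior K" for y
    using that in_closure_iff_infdist_zero[OF nK, of y] w0[of y]
    by (auto simp: w_def closure_complement less_le)
  have wc: "continuous_on S w" for S
    unfolding w_def by (intro continuous_intros)
  define Z where "Z x = integral (cbox a b) (\<lambda>y. exp (x \<bullet> y) *\<^sub>R w y)" for x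
  define N where "N x = integral (cbox a b) (\<lambda>y. exp (x \<bullet> y) *\<^sub>R (w y *\<^sub>R y))" for x
  define B where "B x h = integral (cbox a b) (\<lambda>y. (exp (x \<bullet> y) * (h \<bullet> y)) *\<^sub>R (w y *\<^sub>R y))" for x h
  have N_int: "(\<lambda>y. exp (x \<bullet> y) *\<^sub>R (w y *\<^sub>R y)) integrable_on cbox a b" for x
    by (intro integrable_continuous continuous_intros wc)
  have B_int: "(\<lambda>y. (exp (x \<bullet> y) * (h \<bullet> y)) *\<^sub>R (w y *\<^sub>R y)) integrable_on cbox a b" for x h
    by (intro integrable_continuous continuous_intros wc)
  have Z_int: "(\<lambda>y. exp (x \<bullet> y) * w y) integrable_on cbox a b" for x
    by (intro integrable_continuous continuous_intros wc)
  have hN: "integral (cbox a b) (\<lambda>y. exp (x \<bullet> y) * w y * (h \<bullet> y)) = h \<bullet> N x" for x h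
    unfolding N_def integral_inner_right[OF N_int, symmetric] by (simp add: mult_ac)
  have hB: "integral (cbox a b) (\<lambda>y. exp (x \<bullet> y) * w y * (h \<bullet> y)\<^sup>2) = h \<bullet> B x h" for x h
    unfolding B_def integral_inner_right[OF B_int, symmetric] by (simp add: mult_ac power2_eq_square)
  have hN_int: "(\<lambda>y. exp (x \<bullet> y) * w y * (h \<bullet> y)) integrable_on cbox a b" for x h
    by (intro integrable_continuous continuous_intros wc)
  have hB_int: "(\<lambda>y. exp (x \<bullet> y) * w y * (h \<bullet> y)\<^sup>2) integrable_on cbox a b" for x h
    by (intro integrable_continuous continuous_intros wc)
  have Z': "(Z has_derivative (\<lambda>h. h \<bullet> N x)) (at x)" for x
    using exp_integral_has_derivative[OF wc, of a b x]
    by (simp add: Z_def[abs_def] hN[symmetric] mult_ac)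
  have N': "(N has_derivative B x) (at x)" for x
    unfolding N_def[abs_def] B_def[abs_def]
    by (rule exp_integral_has_derivative) (intro continuous_intros wc)
  obtain y0 where y0: "y0 \<in> interior K" using assms(3) by blast
  have Zpos: "Z x > 0" for x
    unfolding Z_def
    by (rule integral_continuous_cbox_pos[of _ _ _ y0])
       (use y0 intK w_pos w0 in \<open>auto intro!: continuous_intros wc\<close>)
  define G where "G x = (1 / Z x) *\<^sub>R N x" for x
  \<comment> \<open>The quotient rule for \<open>N / Z\<close>; \<open>h \<bullet> D x h\<close> is
    the variance of \<open>h \<bullet> y\<close>, second moment minus squared mean.\<close>
  define D where "D x h = (1 / Z x) *\<^sub>R B x h - ((h \<bullet> N x) / (Z x)\<^sup>2) *\<^sub>R N x" for x h
  have G': "(G has_derivative D x) (at x)" for x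
    unfolding G_def[abs_def] D_def[abs_def] using Zpos[of x]
    by (auto intro!: derivative_eq_intros Z' N' simp: fun_eq_iff power2_eq_square divide_simps)
  define H where "H x = matrix (D x)" for x
  have H: "H x *v h = D x h" for x h
    unfolding H_def using has_derivative_linear[OF G'] by (simp add: matrix_works)
  show thesis
  proof
    show "((\<lambda>x. ln (Z x)) has_derivative (\<lambda>h. G x \<bullet> h)) (at x)" for x
      using Zpos[of x]
      by (auto intro!: derivative_eq_intros Z' simp: fun_eq_iff G_def inner_commute divide_simps)
    show "(G has_derivative (\<lambda>h. H x *v h)) (at x)" for x
      using G'[of x] by (simp add: H)
    show "0 < h \<bullet> (H x *v h)" if h: "h \<noteq> 0" for x h
    proof -
      define m where "m = (h \<bullet> N x) / Z x"
      \<comment> \<open>A hyperplane has empty interior, so some \<open>y1\<close> with positive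
        weight satisfies \<open>h \<bullet> y1 \<noteq> m\<close>, and the variance integral below
        is positive.\<close>
      have "\<not> interior K \<subseteq> {y. h \<bullet> y = m}"
        using interior_maximal[OF _ open_interior, of K "{y. h \<bullet> y = m}"] assms(3) interior_hyperplane[OF h]
        by auto
      then obtain y1 where y1: "y1 \<in> interior K" "h \<bullet> y1 \<noteq> m" by auto
      have "0 < integral (cbox a b) (\<lambda>y. exp (x \<bullet> y) * w y * (h \<bullet> y - m)\<^sup>2)"
        by (rule integral_continuous_cbox_pos[of _ _ _ y1])
           (use y1 intK w_pos w0 in \<open>auto intro!: continuous_intros wc\<close>)
      also have "(\<lambda>y. exp (x \<bullet> y) * w y * (h \<bullet> y - m)\<^sup>2) =
          (\<lambda>y. (exp (x \<bullet> y) * w y * (h \<bullet> y)\<^sup>2 - 2 * m * (exp (x \<bullet> y) * w y * (h \<bullet> y))) + m\<^sup>2 * (exp (x \<bullet> y) * w y))"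
        by (auto simp: fun_eq_iff power2_eq_square algebra_simps)
      also have "integral (cbox a b) \<dots> = h \<bullet> B x h - 2 * m * (h \<bullet> N x) + m\<^sup>2 * Z x"
        by (subst integral_add integral_diff, (intro integrable_diff integrable_on_mult_right hN_int hB_int Z_int)+)+
           (simp add: hN hB Z_def)
      also have "\<dots> = Z x * (h \<bullet> D x h)"
        using Zpos[of x] by (simp add: D_def m_def inner_diff_right field_simps power2_eq_square)
      finally show ?thesis
        using Zpos[of x] by (simp add: H zero_less_mult_iff)
    qed
    show "G x \<in> K" for x
    proof (rule ccontr)
      assume "G x \<notin> K"
      then obtain u c where u: "u \<bullet> G x < c" "\<And>y. y \<in> K \<Longrightarrow> u \<bullet> y > c"
        using separating_hyperplane_closed_point[OF assms(2) compact_imp_closed[OF assms(1)]] by blast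
      \<comment> \<open>Averaging the separating inequality over the density yields
        \<open>c \<le> u \<bullet> G x\<close>, against the choice of \<open>u\<close>; off
        \<open>K\<close> both integrands vanish.\<close>
      have "integral (cbox a b) (\<lambda>y. c * (exp (x \<bullet> y) * w y)) \<le> integral (cbox a b) (\<lambda>y. exp (x \<bullet> y) * w y * (u \<bullet> y))"
      proof (rule integral_le)
        show "c * (exp (x \<bullet> y) * w y) \<le> exp (x \<bullet> y) * w y * (u \<bullet> y)" for y
          using mult_left_mono[of c "u \<bullet> y" "exp (x \<bullet> y) * w y"] u(2)[of y] w0[of y] w_out[of y]
          by (cases "y \<in> K") (auto simp: mult_ac)
      qed (intro integrable_on_mult_right Z_int hN_int)+
      then have "c * Z x \<le> u \<bullet> N x" by (simp add: hN Z_def)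
      then show False using u(1) Zpos[of x] by (simp add: G_def field_simps)
    qed
    show "\<exists>c>0. \<exists>d. \<forall>x. c * norm x - d \<le> ln (Z x) - p \<bullet> x" if p: "p \<in> interior K" for p
    proof -
      obtain r where r: "r > 0" "cball p r \<subseteq> interior K"
        using p open_contains_cball[of "interior K"] by auto
      obtain y1 where y1: "y1 \<in> cball p r" "\<And>y. y \<in> cball p r \<Longrightarrow> w y1 \<le> w y"
        using continuous_attains_inf[OF compact_cball _ wc, of p r] r(1) by auto
      have wy1: "w y1 > 0" using y1 r w_pos by blast
      define v where "v = measure lebesgue (cball (0::real^'m) (r / 4))"
      have v: "v > 0" using r content_cball_pos[of "r / 4" "0::real^'m"] by (simp add: v_def)
      have "r / 4 * norm x - (- ln (w y1 * v)) \<le> ln (Z x) - p \<bullet> x" for x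
      proof -
        \<comment> \<open>The ball of radius \<open>r / 4\<close> around \<open>q\<close> stays
          within \<open>cball p r\<close>, where \<open>w \<ge> w y1\<close>. On it
          \<open>x \<bullet> y\<close> exceeds \<open>x \<bullet> p\<close> by at least
          \<open>(r / 2 - r / 4) * norm x\<close>, so this ball alone gives linear growth of
          \<open>ln (Z x) - p \<bullet> x\<close>. For \<open>x = 0\<close> the shift is
          zero.\<close>
        define q where "q = p + (r / 2) *\<^sub>R sgn x"
        have xs: "x \<bullet> sgn x = norm x" by (simp add: sgn_div_norm dot_square_norm power2_eq_square divide_simps)
        have sub: "cball q (r / 4) \<subseteq> cball p r"
        proof
          fix y assume "y \<in> cball q (r / 4)"
          moreover have "dist p q \<le> r / 2" using r by (simp add: q_def dist_norm norm_sgn)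
          ultimately show "y \<in> cball p r"
            using dist_triangle[of p y q] r by simp
        qed
        have le: "exp (x \<bullet> p + r / 4 * norm x) * w y1 \<le> exp (x \<bullet> y) * w y" if "y \<in> cball q (r / 4)" for y
        proof (intro mult_mono)
          have "\<bar>x \<bullet> (y - q)\<bar> \<le> norm x * (r / 4)"
            using that by (intro order_trans[OF Cauchy_Schwarz_ineq2] mult_left_mono) (auto simp: dist_norm norm_minus_commute)
          from abs_le_D2[OF this] show "exp (x \<bullet> p + r / 4 * norm x) \<le> exp (x \<bullet> y)"
            by (simp add: q_def inner_diff_right inner_add_right xs algebra_simps)
        qed (use y1 sub that w0 in auto)
        have meas: "cball q (r / 4) \<in> lmeasurable" by simp
        have "((\<lambda>y. exp (x \<bullet> p + r / 4 * norm x) * w y1 * 1) has_integral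
            exp (x \<bullet> p + r / 4 * norm x) * w y1 * measure lebesgue (cball q (r / 4))) (cball q (r / 4))"
          using meas by (intro has_integral_mult_right)
            (simp only: has_integral_iff lmeasure_integral lmeasurable_iff_integrable_on)
        moreover have "measure lebesgue (cball q (r / 4)) = v"
          unfolding v_def using r by (simp add: content_cball)
        moreover have int2: "(\<lambda>y. exp (x \<bullet> y) * w y) integrable_on cball q (r / 4)"
          by (intro set_borel_integral_eq_integral(1)[unfolded set_integrable_def]
              borel_integrable_compact continuous_intros wc compact_cball)
        ultimately have "exp (x \<bullet> p + r / 4 * norm x) * w y1 * v \<le> integral (cball q (r / 4)) (\<lambda>y. exp (x \<bullet> y) * w y)"
          using has_integral_le[OF _ integrable_integral[OF int2]] le by fastforce
        also have "\<dots> \<le> Z x"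
          unfolding Z_def using sub r(2) intK box_subset_cbox[of a b] w0 Z_int
          by (simp, intro integral_subset_le int2) auto
        finally have "ln (exp (x \<bullet> p + r / 4 * norm x) * (w y1 * v)) \<le> ln (Z x)"
          using Zpos[of x] wy1 v by (simp add: mult_ac)
        then show ?thesis using wy1 v by (simp add: ln_mult inner_commute)
      qed
      then have "\<exists>d. \<forall>x. r / 4 * norm x - d \<le> ln (Z x) - p \<bullet> x" by blast
      then show ?thesis using r(1) by (intro exI[of _ "r / 4"]) auto
    qed
  qed
qed

section \<open>Volumes of Minkowski combinations\<close>

lemma det_pos_if_pos_definite:
  fixes A :: "real^'m^'m"
  assumes A: "\<And>h. h \<noteq> 0 \<Longrightarrow> 0 < h \<bullet> (A *v h)"
  shows "det A > 0"
proof (rule ccontr)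
  assume neg: "\<not> det A > 0"
  \<comment> \<open>Every matrix on the segment from the identity to \<open>A\<close> has a positive
    quadratic form, hence trivial kernel; by the intermediate value theorem the determinant cannot
    change sign along it.\<close>
  define f where "f t = det ((1 - t) *\<^sub>R mat 1 + t *\<^sub>R A)" for t :: real
  have "continuous_on {0..1} f"
    unfolding f_def det_def by (intro continuous_intros)
  moreover have "f 0 = 1" "f 1 = det A" by (simp_all add: f_def)
  ultimately obtain t where t: "0 \<le> t" "t \<le> 1" "f t = 0"
    using IVT2'[of f 1 0 0] neg by auto
  then obtain h where h: "h \<noteq> 0" "((1 - t) *\<^sub>R mat 1 + t *\<^sub>R A) *v h = 0"
    unfolding f_def by (metis invertible_det_nz invertible_left_inverse matrix_left_invertible_ker)
  have "h \<bullet> (((1 - t) *\<^sub>R mat 1 + t *\<^sub>R A) *v h) = (1 - t) * (h \<bullet> h) + t * (h \<bullet> (A *v h))"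
    by (simp add: matrix_vector_mult_add_rdistrib scaleR_matrix_vector_assoc[symmetric] inner_add_right)
  moreover have "\<dots> > 0"
    using t h A[OF h(1)] by (cases "t = 0") (auto intro!: add_nonneg_pos)
  ultimately show False using h by simp
qed

text \<open>Along the segment from \<open>x\<close> to \<open>y\<close> the component of
  \<open>T\<close> in the direction \<open>y - x\<close> has positive derivative, so its values at
  the two ends differ.\<close>

lemma inj_if_derivative_pos_definite:
  fixes T :: "'a::real_inner \<Rightarrow> 'a"
  assumes T': "\<And>x. (T has_derivative T' x) (at x)"
    and pos: "\<And>x h. h \<noteq> 0 \<Longrightarrow> 0 < h \<bullet> T' x h"
  shows "inj T"
proof (rule injI, rule ccontr)
  fix x y assume eq: "T x = T y" and ne: "x \<noteq> y"
  define h where "h = y - x"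
  have "((\<lambda>t. h \<bullet> T (x + t *\<^sub>R h)) has_derivative (\<lambda>s. s * (h \<bullet> T' (x + t *\<^sub>R h) h))) (at t)" for t
  proof -
    have "linear (T' (x + t *\<^sub>R h))" using T' has_derivative_linear by blast
    moreover have "((\<lambda>t. T (x + t *\<^sub>R h)) has_derivative (\<lambda>s. T' (x + t *\<^sub>R h) (s *\<^sub>R h))) (at t)"
      by (rule has_derivative_compose[OF _ T', unfolded o_def]) (auto intro!: derivative_eq_intros)
    ultimately show ?thesis
      by (auto intro!: derivative_eq_intros simp: linear_scale)
  qed
  from mvt_very_simple[of 0 1, OF _ has_derivative_at_withinI[OF this]]
  obtain t where "h \<bullet> T (x + 1 *\<^sub>R h) - h \<bullet> T (x + 0 *\<^sub>R h) = (1 - 0) * (h \<bullet> T' (x + t *\<^sub>R h) h)"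
    by auto
  then show False using pos[of h "x + t *\<^sub>R h"] eq ne by (simp add: h_def)
qed

text \<open>A coercive continuous function attains its minimum, and at a minimiser of
  \<open>\<Psi> x - p \<bullet> x\<close> the gradient \<open>T x - p\<close> vanishes.\<close>

lemma surj_gradient_if_coercive:
  fixes \<Psi> :: "'a::euclidean_space \<Rightarrow> real"
  assumes \<Psi>': "\<And>x. (\<Psi> has_derivative (\<lambda>h. T x \<bullet> h)) (at x)"
    and "c > 0" and coercive: "\<And>x. c * norm x - d \<le> \<Psi> x - p \<bullet> x"
  shows "p \<in> range T"
proof -
  define f where "f x = \<Psi> x - p \<bullet> x" for x
  have f': "(f has_derivative (\<lambda>h. T x \<bullet> h - p \<bullet> h)) (at x)" for x
    unfolding f_def by (intro derivative_intros \<Psi>')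
  \<comment> \<open>Outside this radius the lower bound already exceeds \<open>f 0\<close>; the
    maximum with 0 keeps the origin inside the ball.\<close>
  define R where "R = max 0 ((f 0 + d) / c)"
  have "continuous_on (cball 0 R) f"
    by (intro continuous_at_imp_continuous_on ballI has_derivative_continuous[OF f'])
  then obtain x0 where x0: "\<forall>x\<in>cball 0 R. f x0 \<le> f x"
    using continuous_attains_inf[OF compact_cball, of 0 R f] by (auto simp: R_def)
  have "f x0 \<le> f x" for x
  proof (cases "x \<in> cball 0 R")
    case False
    then have "(f 0 + d) / c < norm x" by (auto simp: R_def)
    then have "f 0 < c * norm x - d" using \<open>c > 0\<close> by (simp add: field_simps)
    also have "\<dots> \<le> f x" using coercive by (simp add: f_def)
    finally show ?thesis using x0[rule_format, of 0] by (simp add: R_def)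
  qed (use x0 in blast)
  then have "(\<lambda>h. T x0 \<bullet> h - p \<bullet> h) = (\<lambda>h. 0)"
    using has_derivative_local_min[OF f', of x0] by simp
  then have "(T x0 - p) \<bullet> (T x0 - p) = 0" by (metis inner_diff_left)
  then show ?thesis by (auto intro: range_eqI[of _ _ x0])
qed

section \<open>Convexity, boundedness and interior of Minkowski combinations\<close>

lemma minkowski_combI: "(\<And>i. x i \<in> K i) \<Longrightarrow> (\<Sum>i\<in>UNIV. l i *\<^sub>R x i) \<in> minkowski_comb l K"
  unfolding minkowski_comb_def by blast

lemma minkowski_combE:
  assumes "z \<in> minkowski_comb l K"
  obtains x where "z = (\<Sum>i\<in>UNIV. l i *\<^sub>R x i)" "\<forall>i. x i \<in> K i"
  using assms unfolding minkowski_comb_def by blast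

lemma convex_minkowski_comb:
  assumes "\<And>i. convex (K i)"
  shows "convex (minkowski_comb l K)"
proof (rule convexI)
  fix x y and u v :: real
  assume xy: "x \<in> minkowski_comb l K" "y \<in> minkowski_comb l K" and uv: "0 \<le> u" "0 \<le> v" "u + v = 1"
  obtain x' where x: "x = (\<Sum>i\<in>UNIV. l i *\<^sub>R x' i)" "\<forall>i. x' i \<in> K i"
    using xy(1) by (rule minkowski_combE)
  obtain y' where y: "y = (\<Sum>i\<in>UNIV. l i *\<^sub>R y' i)" "\<forall>i. y' i \<in> K i"
    using xy(2) by (rule minkowski_combE)
  have "u *\<^sub>R x + v *\<^sub>R y = (\<Sum>i\<in>UNIV. l i *\<^sub>R (u *\<^sub>R x' i + v *\<^sub>R y' i))"
    unfolding x y by (simp add: scaleR_right_distrib sum.distrib scaleR_sum_right mult.commute)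
  then show "u *\<^sub>R x + v *\<^sub>R y \<in> minkowski_comb l K"
    using x(2) y(2) uv assms minkowski_combI[of "\<lambda>i. u *\<^sub>R x' i + v *\<^sub>R y' i" K l] by (simp add: convexD)
qed

lemma bounded_minkowski_comb:
  fixes K :: "'i::finite \<Rightarrow> 'a::real_normed_vector set"
  assumes "\<And>i. bounded (K i)"
  shows "bounded (minkowski_comb l K)"
proof -
  obtain b where b: "\<And>i x. x \<in> K i \<Longrightarrow> norm x \<le> b i"
    using assms unfolding bounded_iff by metis
  have "norm z \<le> (\<Sum>i\<in>UNIV. \<bar>l i\<bar> * b i)" if "z \<in> minkowski_comb l K" for z
    using that by (auto elim!: minkowski_combE intro!: sum_norm_le mult_left_mono b)
  then show ?thesis unfolding bounded_iff by blast
qed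

text \<open>Push \<open>p\<close> slightly away from a combination \<open>q'\<close> of interior
  points, decompose the result into points \<open>k i\<close>, and shrink each \<open>k i\<close>
  towards \<open>q i\<close>. The shrinking makes the points interior and undoes the push.\<close>

lemma interior_minkowski_comb_subset:
  fixes K :: "'i::finite \<Rightarrow> 'a::euclidean_space set"
  assumes "\<And>i. convex (K i)" "\<And>i. interior (K i) \<noteq> {}"
  shows "interior (minkowski_comb l K) \<subseteq> minkowski_comb l (\<lambda>i. interior (K i))"
proof
  fix p assume p: "p \<in> interior (minkowski_comb l K)"
  have "\<forall>i. \<exists>q. q \<in> interior (K i)" using assms(2) by blast
  then obtain q where q: "\<And>i. q i \<in> interior (K i)" by metis
  define q' where "q' = (\<Sum>i\<in>UNIV. l i *\<^sub>R q i)"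
  obtain e where e: "e > 0" "cball p e \<subseteq> minkowski_comb l K"
    using p mem_interior_cball by blast
  \<comment> \<open>The extra \<open>e\<close> in the denominator keeps \<open>t\<close> well
    defined and positive even when \<open>p = q'\<close>.\<close>
  define t where "t = e / (e + norm (p - q'))"
  have "e + norm (p - q') > 0" using e(1) by (simp add: add_pos_nonneg)
  then have t: "0 < t" "t * norm (p - q') \<le> e"
    using e(1) by (simp_all add: t_def pos_divide_le_eq distrib_left)
  have "p + t *\<^sub>R (p - q') \<in> minkowski_comb l K"
    using t by (intro subsetD[OF e(2)]) (simp add: dist_norm)
  then obtain k where k: "p + t *\<^sub>R (p - q') = (\<Sum>i\<in>UNIV. l i *\<^sub>R k i)" "\<forall>i. k i \<in> K i"
    by (rule minkowski_combE)
  \<comment> \<open>The ratio \<open>t / (1 + t)\<close> is forced: the pushed point minus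
    \<open>q'\<close> is \<open>(1 + t)\<close> times \<open>p - q'\<close>, and exactly
    \<open>t\<close> times \<open>p - q'\<close> has to be removed.\<close>
  define m where "m i = k i - (t / (1 + t)) *\<^sub>R (k i - q i)" for i
  have "m i \<in> interior (K i)" for i
    unfolding m_def using t by (intro mem_interior_convex_shrink assms q k(2)[rule_format]) auto
  moreover have "p = (\<Sum>i\<in>UNIV. l i *\<^sub>R m i)"
  proof -
    have "(\<Sum>i\<in>UNIV. l i *\<^sub>R m i) = (\<Sum>i\<in>UNIV. l i *\<^sub>R k i) - (t / (1 + t)) *\<^sub>R ((\<Sum>i\<in>UNIV. l i *\<^sub>R k i) - q')"
      by (simp add: m_def q'_def scaleR_right_diff_distrib sum_subtractf scaleR_sum_right mult.commute)
    also have "(\<Sum>i\<in>UNIV. l i *\<^sub>R k i) - q' = (1 + t) *\<^sub>R (p - q')"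
      unfolding k(1)[symmetric] by (simp add: algebra_simps)
    also have "(\<Sum>i\<in>UNIV. l i *\<^sub>R k i) - (t / (1 + t)) *\<^sub>R \<dots> = p"
      unfolding k(1)[symmetric] using t by simp
    finally show ?thesis ..
  qed
  ultimately show "p \<in> minkowski_comb l (\<lambda>i. interior (K i))"
    using minkowski_combI[of m] by metis
qed

section \<open>Minkowski's theorem for a well-ordered index type\<close>

lemma sum_matrix_vector_mult:
  fixes A :: "'i \<Rightarrow> real^'n^'m"
  shows "(\<Sum>i\<in>I. A i) *v x = (\<Sum>i\<in>I. A i *v x)"
  by (induction I rule: infinite_finite_induct) (auto simp: matrix_vector_mult_add_rdistrib)

lemma minkowski_volume_wellorder:
  fixes K :: "'i::finite \<Rightarrow> (real^'m::{finite,wellorder}) set"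
  assumes K: "\<And>i. compact (K i)" "\<And>i. convex (K i)" "\<And>i. interior (K i) \<noteq> {}"
  obtains V where "homogeneous_form CARD('m) V"
    and "\<And>l. (\<And>i. l i > 0) \<Longrightarrow> measure lebesgue (minkowski_comb l K) = V l"
proof -
  \<comment> \<open>Bundling the properties into one predicate lets a single choice pick
    \<open>\<phi>\<close>, \<open>G\<close> and \<open>H\<close> consistently for all
    \<open>i\<close>.\<close>
  define props where "props i \<phi> G H \<longleftrightarrow>
    (\<forall>x. (\<phi> has_derivative (\<lambda>h. G x \<bullet> h)) (at x)) \<and>
    (\<forall>x. (G has_derivative (\<lambda>h. H x *v h)) (at x)) \<and>
    (\<forall>x h. h \<noteq> 0 \<longrightarrow> 0 < h \<bullet> (H x *v h)) \<and> (\<forall>x. G x \<in> K i) \<and>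
    (\<forall>p\<in>interior (K i). \<exists>c>0. \<exists>d. \<forall>x. c * norm x - d \<le> \<phi> x - p \<bullet> x)"
    for i and \<phi> :: "real^'m::_ \<Rightarrow> real" and G and H :: "real^'m::_ \<Rightarrow> real^'m::_^'m::_"
  have "\<exists>\<phi> G H. props i \<phi> G H" for i
    unfolding props_def by (rule convex_body_potential[OF K, of i]) blast
  then obtain \<phi> G H where "\<And>i. props i (\<phi> i) (G i) (H i)" by metis
  then have \<phi>': "\<And>i x. (\<phi> i has_derivative (\<lambda>h. G i x \<bullet> h)) (at x)"
    and G': "\<And>i x. (G i has_derivative (\<lambda>h. H i x *v h)) (at x)"
    and H: "\<And>i x h. h \<noteq> 0 \<Longrightarrow> 0 < h \<bullet> (H i x *v h)"
    and GK: "\<And>i x. G i x \<in> K i"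
    and coer: "\<And>i p. p \<in> interior (K i) \<Longrightarrow> \<exists>c>0. \<exists>d. \<forall>x. c * norm x - d \<le> \<phi> i x - p \<bullet> x"
    unfolding props_def by auto
  define P where "P x l = det (\<Sum>i\<in>UNIV. l i *\<^sub>R H i x)" for x and l :: "'i \<Rightarrow> real"
  have main: "(\<lambda>x. P x l) integrable_on UNIV \<and>
      integral UNIV (\<lambda>x. P x l) = measure lebesgue (minkowski_comb l K)"
    if l: "\<And>i. l i > 0" for l
  proof -
    define T where "T x = (\<Sum>i\<in>UNIV. l i *\<^sub>R G i x)" for x
    define HT where "HT x = (\<Sum>i\<in>UNIV. l i *\<^sub>R H i x)" for x
    have HTv: "HT x *v h = (\<Sum>i\<in>UNIV. l i *\<^sub>R (H i x *v h))" for x h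
      unfolding HT_def scaleR_matrix_vector_assoc by (rule sum_matrix_vector_mult)
    have T': "(T has_derivative (\<lambda>h. HT x *v h)) (at x)" for x
      unfolding T_def HTv by (intro derivative_intros G')
    have HTpos: "0 < h \<bullet> (HT x *v h)" if "h \<noteq> 0" for x h
      unfolding HTv inner_sum_right using l H[OF that] by (intro sum_pos) auto
    have inj: "inj T"
      using T' HTpos by (rule inj_if_derivative_pos_definite)
    have sub: "range T \<subseteq> minkowski_comb l K"
      unfolding T_def using GK by (auto intro: minkowski_combI)
    have sup: "interior (minkowski_comb l K) \<subseteq> range T"
    proof
      fix p assume "p \<in> interior (minkowski_comb l K)"
      then have "p \<in> minkowski_comb l (\<lambda>i. interior (K i))"
        using interior_minkowski_comb_subset[of K l] K by blast
      then obtain q where p: "p = (\<Sum>i\<in>UNIV. l i *\<^sub>R q i)" and "\<forall>i. q i \<in> interior (K i)"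
        by (rule minkowski_combE)
      then have q: "\<And>i. q i \<in> interior (K i)" by blast
      \<comment> \<open>Decomposing \<open>p\<close> into interior points \<open>q i\<close> splits
        \<open>\<Sum> l i * \<phi> i x - p \<bullet> x\<close> into summands that are each coercive;
        the constants add up with weights \<open>l i\<close>.\<close>
      obtain c d where c: "\<And>i. c i > 0" and cd: "\<And>i x. c i * norm x - d i \<le> \<phi> i x - q i \<bullet> x"
        using coer[OF q] by metis
      show "p \<in> range T"
      proof (rule surj_gradient_if_coercive)
        show "((\<lambda>x. \<Sum>i\<in>UNIV. l i * \<phi> i x) has_derivative (\<lambda>h. T x \<bullet> h)) (at x)" for x
          unfolding T_def inner_sum_left inner_scaleR_left by (intro derivative_intros \<phi>')
        show "(\<Sum>i\<in>UNIV. l i * c i) > 0" using l c by (intro sum_pos) auto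
        show "(\<Sum>i\<in>UNIV. l i * c i) * norm x - (\<Sum>i\<in>UNIV. l i * d i) \<le> (\<Sum>i\<in>UNIV. l i * \<phi> i x) - p \<bullet> x" for x
        proof -
          have "(\<Sum>i\<in>UNIV. l i * (c i * norm x - d i)) \<le> (\<Sum>i\<in>UNIV. l i * (\<phi> i x - q i \<bullet> x))"
            using l by (intro sum_mono mult_left_mono cd) (auto simp: less_imp_le)
          then show ?thesis
            by (simp add: p inner_sum_left sum_subtractf right_diff_distrib sum_distrib_right mult.assoc)
        qed
      qed
    qed
    have cvx: "convex (minkowski_comb l K)" and bdd: "bounded (minkowski_comb l K)"
      using K compact_imp_bounded by (auto intro!: convex_minkowski_comb bounded_minkowski_comb)
    have meas: "minkowski_comb l K \<in> lmeasurable" using cvx bdd by (rule measurable_convex)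
    \<comment> \<open>The range of \<open>T\<close> lies between the interior of the combination and
      the combination itself, so they differ only within the frontier, which is negligible by
      convexity.\<close>
    have "minkowski_comb l K - range T \<union> (range T - minkowski_comb l K) \<subseteq> frontier (minkowski_comb l K)"
      using sub sup closure_subset unfolding frontier_def by blast
    then have negl: "negligible (minkowski_comb l K - range T \<union> (range T - minkowski_comb l K))"
      using negligible_convex_frontier[OF cvx] negligible_subset by blast
    have rT: "range T \<in> lmeasurable" "measure lebesgue (range T) = measure lebesgue (minkowski_comb l K)"
      by (rule lmeasurable_negligible_symdiff[OF meas negl], rule measure_negligible_symdiff[OF meas negl])
    \<comment> \<open>Definiteness removes the absolute value from the change of variables; without
      it the integrand would not be polynomial in \<open>l\<close>.\<close>
    have absdet: "\<bar>det (matrix (\<lambda>h. HT x *v h))\<bar> = P x l" for x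
      using det_pos_if_pos_definite[OF HTpos] by (simp add: P_def HT_def[symmetric] abs_of_pos)
    \<comment> \<open>For an injective differentiable map, measurability of the image with finite
      measure is equivalent to integrability of the Jacobian; the former is already known from
      \<open>rT\<close>.\<close>
    have P_int: "(\<lambda>x. P x l) integrable_on UNIV"
      using measurable_differentiable_image_eq[OF _ T' inj] rT(1) unfolding absdet by simp
    moreover have "measure lebesgue (range T) = integral UNIV (\<lambda>x. P x l)"
      using measure_differentiable_image_eq[OF _ T' inj, unfolded absdet, OF _ P_int] by simp
    ultimately show ?thesis using rT(2) by simp
  qed
  show thesis
  proof (rule integral_homogeneous_form[of "CARD('m)" P UNIV])
    show "homogeneous_form CARD('m) (P x)" for x
      unfolding P_def by (rule homogeneous_form_det)
    show "(\<lambda>x. P x l) integrable_on UNIV" if "\<And>i. l i > 0" for l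
      using main[of l] that by simp
    fix V assume V: "homogeneous_form CARD('m) V"
      "\<And>l. (\<And>i. l i > 0) \<Longrightarrow> integral UNIV (\<lambda>x. P x l) = V l"
    show thesis
    proof (rule that[OF V(1)])
      show "measure lebesgue (minkowski_comb l K) = V l" if l: "\<And>i. l i > 0" for l
        using main[of l] V(2)[of l] l by simp
    qed
  qed
qed

section \<open>Transfer to an arbitrary finite index type\<close>

text \<open>The change of variables theorem is available only for \<^typ>\<open>real^'m\<close> with a well-ordered index
  type, hence this well-ordered copy of a finite type.\<close>

typedef 'a index = "{..CARD('a) - 1}" by auto

instantiation index :: (type) wellorder
begin
definition less_eq_index :: "'a index \<Rightarrow> 'a index \<Rightarrow> bool" where
  "less_eq_index i j \<longleftrightarrow> Rep_index i \<le> Rep_index j"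
definition less_index :: "'a index \<Rightarrow> 'a index \<Rightarrow> bool" where
  "less_index i j \<longleftrightarrow> Rep_index i < Rep_index j"
instance
proof
  fix P :: "'a index \<Rightarrow> bool" and a
  assume step: "\<And>x. (\<And>y. y < x \<Longrightarrow> P y) \<Longrightarrow> P x"
  show "P a"
  proof (induction "Rep_index a" arbitrary: a rule: less_induct)
    case less
    show ?case
      by (rule step, rule less) (simp add: less_index_def)
  qed
qed (auto simp: less_eq_index_def less_index_def Rep_index_inject)
end

lemma UNIV_index: "(UNIV :: 'a index set) = Abs_index ` {..CARD('a) - 1}"
  by (rule type_definition.univ[OF type_definition_index])

instance index :: (type) finite
  by standard (simp add: UNIV_index)

text \<open>The set \<open>{..CARD('a) - 1}\<close> has one element more than its upper bound, and
  \<open>CARD('a)\<close> is positive for finite \<open>'a\<close>. For infinite \<open>'a\<close>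
  the cardinality is 0 and the copy is a singleton, which is why \<open>'a index\<close> is finite
  without any sort constraint.\<close>

lemma card_index: "CARD('a::finite index) = CARD('a)"
  by (subst type_definition.card[OF type_definition_index]) simp

lemma prod_Basis_vec: "(\<Prod>b\<in>Basis. (x::real^'n) \<bullet> b) = (\<Prod>i\<in>UNIV. x $ i)"
proof -
  have B: "(Basis :: (real^'n) set) = range (\<lambda>i. axis i 1)" by (auto simp: Basis_vec_def)
  have "inj (\<lambda>i::'n. axis i (1::real))" by (auto simp: inj_def axis_eq_axis)
  then show ?thesis unfolding B by (subst prod.reindex) (simp_all add: inner_axis)
qed

text \<open>Relabelling coordinates turns boxes into boxes with the same side lengths, and
  Lebesgue-Borel measure is determined by its values on boxes.\<close>

lemma distr_lborel_reindex:
  fixes g :: "'m::finite \<Rightarrow> 'n::finite"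
  assumes g: "bij g"
  shows "distr lborel borel (\<lambda>x::real^'n. (\<chi> j. x $ g j) :: real^'m) = lborel"
proof (rule lborel_eqI[symmetric])
  define L :: "real^'n \<Rightarrow> real^'m" where "L x = (\<chi> j. x $ g j)" for x
  fix l u :: "real^'m" assume le: "\<And>b. b \<in> Basis \<Longrightarrow> l \<bullet> b \<le> u \<bullet> b"
  have L: "L \<in> borel_measurable borel"
    unfolding L_def by (intro borel_measurable_continuous_onI continuous_intros)
  define l' u' :: "real^'n" where "l' = (\<chi> i. l $ inv g i)" and "u' = (\<chi> i. u $ inv g i)"
  have gi: "inv g (g j) = j" "g (inv g i) = i" for i j
    using g by (simp_all add: bij_is_inj bij_is_surj surj_f_inv_f)
  have lu: "l $ j \<le> u $ j" for j using le[of "axis j 1"] by (simp add: inner_axis)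
  have "emeasure (distr lborel borel L) (box l u) = emeasure lborel (L -` box l u)"
    using L by (subst emeasure_distr) auto
  also have "L -` box l u = box l' u'"
  proof (rule set_eqI)
    fix x
    have "(\<forall>j. l $ j < x $ g j \<and> x $ g j < u $ j) \<longleftrightarrow> (\<forall>i. l $ inv g i < x $ i \<and> x $ i < u $ inv g i)"
      by (metis gi)
    then show "x \<in> L -` box l u \<longleftrightarrow> x \<in> box l' u'"
      by (simp add: mem_box_cart L_def l'_def u'_def)
  qed
  also have "emeasure lborel (box l' u') = (\<Prod>b\<in>Basis. (u' - l') \<bullet> b)"
    by (intro emeasure_lborel_box) (auto simp: Basis_vec_def inner_axis l'_def u'_def lu)
  also have "\<dots> = (\<Prod>b\<in>Basis. (u - l) \<bullet> b)"
    unfolding prod_Basis_vec using prod.reindex_bij_betw[OF g, of "\<lambda>i. (u' - l') $ i"]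
    by (simp add: l'_def u'_def gi)
  finally show "emeasure (distr lborel borel L) (box l u) = (\<Prod>b\<in>Basis. (u - l) \<bullet> b)" .
qed simp

lemma minkowski_comb_linear_image:
  assumes "linear f"
  shows "minkowski_comb l (\<lambda>i. f ` K i) = f ` minkowski_comb l K"
proof (intro equalityI subsetI)
  fix z assume "z \<in> minkowski_comb l (\<lambda>i. f ` K i)"
  then obtain x where z: "z = (\<Sum>i\<in>UNIV. l i *\<^sub>R x i)" and "\<forall>i. x i \<in> f ` K i"
    by (rule minkowski_combE)
  then have "\<forall>i. \<exists>y. x i = f y \<and> y \<in> K i" by blast
  then obtain y where y: "\<And>i. x i = f (y i)" "\<And>i. y i \<in> K i"
    unfolding choice_iff by blast
  have "z = f (\<Sum>i\<in>UNIV. l i *\<^sub>R y i)"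
    unfolding z y(1) using assms by (simp add: linear_sum linear_scale)
  then show "z \<in> f ` minkowski_comb l K"
    using y(2) by (auto intro: minkowski_combI)
next
  fix z assume "z \<in> f ` minkowski_comb l K"
  then obtain w where z: "z = f w" and "w \<in> minkowski_comb l K" by blast
  from this(2) obtain x where w: "w = (\<Sum>i\<in>UNIV. l i *\<^sub>R x i)" and x: "\<forall>i. x i \<in> K i"
    by (rule minkowski_combE)
  have "z = (\<Sum>i\<in>UNIV. l i *\<^sub>R f (x i))"
    unfolding z w using assms by (simp add: linear_sum linear_scale)
  then show "z \<in> minkowski_comb l (\<lambda>i. f ` K i)"
    using x by (simp add: minkowski_combI)
qed

lemma measure_convex_reindex:
  fixes g :: "'m::finite \<Rightarrow> 'n::finite" and S :: "(real^'n) set"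
  assumes g: "bij g" and S: "convex S" "bounded S"
  shows "measure lebesgue ((\<lambda>x. (\<chi> j. x $ g j) :: real^'m) ` S) = measure lebesgue S"
proof -
  define L :: "real^'n \<Rightarrow> real^'m" where "L x = (\<chi> j. x $ g j)" for x
  define M :: "real^'m \<Rightarrow> real^'n" where "M y = (\<chi> i. y $ inv g i)" for y
  have gi: "inv g (g j) = j" "g (inv g i) = i" for i j
    using g by (simp_all add: bij_is_inj bij_is_surj surj_f_inv_f)
  have LM: "L (M y) = y" "M (L x) = x" for x y by (simp_all add: L_def M_def gi)
  have bij: "bij L" using LM by (intro bij_betwI[of _ _ _ M]) auto
  have lin: "linear L" unfolding L_def by (intro linearI) (simp_all add: vec_eq_iff)
  have vim: "L ` A = M -` A" for A
    by (auto simp: LM intro: image_eqI[of _ L, OF LM(1)[symmetric]])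
  have M: "M \<in> borel_measurable borel"
    unfolding M_def by (intro borel_measurable_continuous_onI continuous_intros)
  have int: "interior (L ` S) = L ` interior S"
    using lin bij by (intro interior_bijective_linear_image) auto
  have "convex (L ` S)" "bounded (L ` S)"
    using lin S by (auto intro: convex_linear_image bounded_linear_image simp: linear_conv_bounded_linear)
  \<comment> \<open>The image measure is controlled on Borel sets only. Passing to the open interior
    costs nothing, as frontiers of convex sets are negligible.\<close>
  then have "measure lebesgue (L ` S) = measure lebesgue (L ` interior S)"
    using measure_interior[of "L ` S"] by (simp add: negligible_convex_frontier int)
  also have "\<dots> = measure lborel (M -` interior S)"
    unfolding vim[symmetric] by (simp add: int[symmetric])
  also have "\<dots> = measure (distr lborel borel M) (interior S)"
    using M by (subst measure_distr) auto
  also have "distr lborel borel M = lborel"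
    unfolding M_def using g by (intro distr_lborel_reindex bij_imp_bij_inv)
  also have "measure lborel (interior S) = measure lebesgue S"
    using measure_interior[of S] S by (simp add: negligible_convex_frontier)
  finally show ?thesis by (simp add: L_def[abs_def])
qed

text \<open>Relabelling the coordinates by \<open>L\<close> preserves compactness, convexity,
  nonempty interior, Minkowski combinations and volume, so the same form \<open>V\<close>
  serves.\<close>

theorem minkowski_volume:
  fixes K :: "'i::finite \<Rightarrow> (real^'n) set"
  assumes K: "\<And>i. compact (K i)" "\<And>i. convex (K i)" "\<And>i. interior (K i) \<noteq> {}"
  obtains V where "homogeneous_form CARD('n) V"
    and "\<forall>l. (\<forall>i. l i > 0) \<longrightarrow> measure lebesgue (minkowski_comb l K) = V l"
proof -
  obtain g :: "'n index \<Rightarrow> 'n" where g: "bij g"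
    using finite_same_card_bij[of "UNIV::'n index set" "UNIV::'n set"] by (auto simp: card_index)
  define L :: "real^'n \<Rightarrow> real^('n index)" where "L x = (\<chi> j. x $ g j)" for x
  have lin: "linear L" unfolding L_def by (intro linearI) (simp_all add: vec_eq_iff)
  have surj: "surj L"
  proof (rule surjI)
    show "L (\<chi> i. y $ inv g i) = y" for y
      using g by (simp add: L_def vec_eq_iff bij_is_inj)
  qed
  obtain V where V: "homogeneous_form CARD('n index) V"
    "\<And>l. (\<And>i. l i > 0) \<Longrightarrow> measure lebesgue (minkowski_comb l (\<lambda>i. L ` K i)) = V l"
  proof (rule minkowski_volume_wellorder[of "\<lambda>i. L ` K i"])
    show "compact (L ` K i)" for i
      using K lin by (intro compact_continuous_image linear_continuous_on) (auto simp: linear_conv_bounded_linear)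
    show "convex (L ` K i)" for i using K lin by (intro convex_linear_image)
    show "interior (L ` K i) \<noteq> {}" for i
    proof -
      have "open (L ` interior (K i))" using lin surj by (intro open_surjective_linear_image) auto
      then have "L ` interior (K i) \<subseteq> interior (L ` K i)"
        by (intro interior_maximal image_mono interior_subset)
      then show ?thesis using K(3)[of i] by auto
    qed
  qed blast
  show thesis
  proof
    show "homogeneous_form CARD('n) V" using V(1) by (simp add: card_index)
    have "measure lebesgue (minkowski_comb l K) = V l" if "\<And>i. l i > 0" for l
    proof -
      have "V l = measure lebesgue (L ` minkowski_comb l K)"
        using V(2)[of l] that by (simp add: minkowski_comb_linear_image[OF lin])
      also have "\<dots> = measure lebesgue (minkowski_comb l K)"
        unfolding L_def using K compact_imp_bounded
        by (intro measure_convex_reindex g convex_minkowski_comb bounded_minkowski_comb) auto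
      finally show ?thesis by simp
    qed
    then show "\<forall>l. (\<forall>i. l i > 0) \<longrightarrow> measure lebesgue (minkowski_comb l K) = V l" by blast
  qed
qed

section \<open>Truncation of regions in a cone\<close>

text \<open>Since \<open>C\<close> contains no line, \<open>C - {0}\<close> is convex and therefore
  contains the convex hull of the unit vectors of \<open>C\<close>. This hull is compact and misses
  0; a functional separating it from 0 is at least \<open>b\<close> on unit vectors, and homogeneity
  gives the rest.\<close>

lemma pointed_cone_functional:
  fixes C :: "'a::euclidean_space set"
  assumes "closed C" "strictly_convex_cone C"
  obtains a b where "b > 0" "\<And>x. x \<in> C \<Longrightarrow> b * norm x \<le> a \<bullet> x"
proof -
  have cone: "\<And>x c. x \<in> C \<Longrightarrow> 0 \<le> c \<Longrightarrow> c *\<^sub>R x \<in> C"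
    and cvx: "convex C" and pointed: "\<And>x. x \<in> C \<Longrightarrow> - x \<in> C \<Longrightarrow> x = 0"
    using assms(2) unfolding strictly_convex_cone_def cone_def by blast+
  have "convex (C - {0})"
  proof (rule convexI)
    fix x y and u v :: real
    assume xy: "x \<in> C - {0}" "y \<in> C - {0}" and uv: "0 \<le> u" "0 \<le> v" "u + v = 1"
    have "u *\<^sub>R x + v *\<^sub>R y \<in> C" using convexD[OF cvx] xy uv by blast
    moreover have "u *\<^sub>R x + v *\<^sub>R y \<noteq> 0"
    proof
      assume "u *\<^sub>R x + v *\<^sub>R y = 0"
      then have eq: "- (u *\<^sub>R x) = v *\<^sub>R y" by (rule minus_unique)
      have 1: "u *\<^sub>R x = 0"
      proof (rule pointed)
        show "u *\<^sub>R x \<in> C" using xy uv by (simp add: cone)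
        show "- (u *\<^sub>R x) \<in> C" unfolding eq using xy uv by (simp add: cone)
      qed
      have "v *\<^sub>R y = 0" unfolding eq[symmetric] 1 by simp
      then show False using 1 xy uv by auto
    qed
    ultimately show "u *\<^sub>R x + v *\<^sub>R y \<in> C - {0}" by blast
  qed
  then have "convex hull (C \<inter> sphere 0 1) \<subseteq> C - {0}"
    by (intro hull_minimal) auto
  then have 0: "0 \<notin> convex hull (C \<inter> sphere 0 1)" by blast
  have "compact (C \<inter> sphere 0 1)" using assms(1) by (intro closed_Int_compact) auto
  then have "closed (convex hull (C \<inter> sphere 0 1))"
    by (intro compact_imp_closed compact_convex_hull)
  then obtain a b where b: "b > 0" and ab: "\<And>x. x \<in> convex hull (C \<inter> sphere 0 1) \<Longrightarrow> b < a \<bullet> x"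
    using separating_hyperplane_closed_0[OF convex_convex_hull _ 0] by blast
  have "b * norm x \<le> a \<bullet> x" if "x \<in> C" for x
  proof (cases "x = 0")
    case False
    have "(1 / norm x) *\<^sub>R x \<in> C \<inter> sphere 0 1"
      using cone[OF that, of "1 / norm x"] False by simp
    then have "b < a \<bullet> ((1 / norm x) *\<^sub>R x)" by (intro ab hull_inc)
    then show ?thesis using False by (simp add: field_simps)
  qed simp
  with b that show thesis by blast
qed

lemma sum_mem_cone:
  assumes "strictly_convex_cone C" "C \<noteq> {}" "\<And>i. i \<in> I \<Longrightarrow> x i \<in> C"
  shows "(\<Sum>i\<in>I. x i) \<in> C"
proof -
  have C: "\<And>x y. x \<in> C \<Longrightarrow> y \<in> C \<Longrightarrow> x + y \<in> C" "0 \<in> C"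
    using assms(1,2) convex_cone[of C] cone_contains_0[of C] unfolding strictly_convex_cone_def by auto
  show ?thesis
    using assms(3) by (induction I rule: infinite_finite_induct) (auto intro: C)
qed

text \<open>A point \<open>x i\<close> lying above the level \<open>s\<close> is scaled down to that level; the total \<open>r\<close> of what is
  cut off is an element of \<open>C\<close> and is distributed over the points below the level, in proportion to
  their distance \<open>d i\<close> from it.\<close>

lemma minkowski_comb_truncate:
  fixes C :: "'a::euclidean_space set" and \<Gamma> :: "'i::finite \<Rightarrow> 'a set"
  assumes C: "strictly_convex_cone C"
    and a: "b > 0" "\<And>x. x \<in> C \<Longrightarrow> b * norm x \<le> a \<bullet> x"
    and \<Gamma>: "\<And>i. C_convex_region C (\<Gamma> i)"
    and s: "s > 0" "\<And>i x. x \<in> C \<Longrightarrow> s \<le> a \<bullet> x \<Longrightarrow> x \<in> \<Gamma> i"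
    and l: "\<And>i. l i > 0"
  shows "minkowski_comb l \<Gamma> \<inter> {x. a \<bullet> x \<le> s * (\<Sum>i\<in>UNIV. l i)} =
    minkowski_comb l (\<lambda>i. \<Gamma> i \<inter> {x. a \<bullet> x \<le> s})"
proof (intro equalityI subsetI)
  fix z assume "z \<in> minkowski_comb l (\<lambda>i. \<Gamma> i \<inter> {x. a \<bullet> x \<le> s})"
  then obtain x where z: "z = (\<Sum>i\<in>UNIV. l i *\<^sub>R x i)" and x: "\<forall>i. x i \<in> \<Gamma> i \<inter> {x. a \<bullet> x \<le> s}"
    by (rule minkowski_combE)
  have "(\<Sum>i\<in>UNIV. l i * (a \<bullet> x i)) \<le> (\<Sum>i\<in>UNIV. l i * s)"
    using x l by (intro sum_mono mult_left_mono) (auto simp: less_imp_le)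
  then show "z \<in> minkowski_comb l \<Gamma> \<inter> {x. a \<bullet> x \<le> s * (\<Sum>i\<in>UNIV. l i)}"
    using x by (auto simp: z inner_sum_right sum_distrib_left mult.commute intro: minkowski_combI)
next
  fix z assume "z \<in> minkowski_comb l \<Gamma> \<inter> {x. a \<bullet> x \<le> s * (\<Sum>i\<in>UNIV. l i)}"
  then have "z \<in> minkowski_comb l \<Gamma>" and zs: "a \<bullet> z \<le> s * (\<Sum>i\<in>UNIV. l i)" by auto
  from this(1) obtain x where z: "z = (\<Sum>i\<in>UNIV. l i *\<^sub>R x i)" and "\<forall>i. x i \<in> \<Gamma> i"
    by (rule minkowski_combE)
  then have x: "x i \<in> \<Gamma> i" for i by blast
  then have xC: "x i \<in> C" for i using \<Gamma>[of i] unfolding C_convex_region_def by blast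
  have cone: "c *\<^sub>R y \<in> C" if "y \<in> C" "0 \<le> c" for y c
    using C that unfolding strictly_convex_cone_def cone_def by blast
  have \<Gamma>_add: "y + w \<in> \<Gamma> i" if "y \<in> \<Gamma> i" "w \<in> C" for y w i
    using \<Gamma>[of i] that unfolding C_convex_region_def by blast
  define t where "t i = (if a \<bullet> x i > s then s / (a \<bullet> x i) else 1)" for i
  have t: "0 \<le> t i" "t i \<le> 1" for i
    using s(1) by (auto simp: t_def)
  define r where "r = (\<Sum>i\<in>UNIV. (l i * (1 - t i)) *\<^sub>R x i)"
  have rC: "r \<in> C"
    unfolding r_def using xC l t by (intro sum_mem_cone[OF C] cone) (auto simp: less_imp_le)
  define d where "d i = s - t i * (a \<bullet> x i)" for i
  have d: "d i \<ge> 0" for i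
    using s(1) by (auto simp: d_def t_def)
  define D where "D = (\<Sum>i\<in>UNIV. l i * d i)"
  have D0: "D \<ge> 0" unfolding D_def using l d by (intro sum_nonneg) (simp add: less_imp_le)
  \<comment> \<open>The level of the part cut off is at most the total room \<open>D\<close> below
    level \<open>s\<close>, precisely because \<open>z\<close> itself lies below
    \<open>s * (\<Sum>i\<in>UNIV. l i)\<close>.\<close>
  have ar: "a \<bullet> r = a \<bullet> z - (\<Sum>i\<in>UNIV. l i * (t i * (a \<bullet> x i)))"
    by (simp add: r_def z inner_sum_right sum_subtractf[symmetric] algebra_simps)
  also have "\<dots> \<le> D"
    using zs by (simp add: D_def d_def sum_distrib_left sum_subtractf right_diff_distrib mult.commute)
  finally have arD: "a \<bullet> r \<le> D" .
  \<comment> \<open>Division by zero yields 0, so for \<open>D = 0\<close> the claim says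
    \<open>r = 0\<close>; indeed \<open>a \<bullet> r \<le> 0\<close> forces this in the
    cone.\<close>
  have rD: "(D / D) *\<^sub>R r = r"
  proof (cases "D = 0")
    case True
    then have "b * norm r \<le> 0" using a(2)[OF rC] arD by simp
    then show ?thesis using a(1) by (simp add: mult_le_0_iff)
  qed simp
  define y where "y i = t i *\<^sub>R x i + (d i / D) *\<^sub>R r" for i
  have "y i \<in> \<Gamma> i" for i
  proof -
    have "t i *\<^sub>R x i \<in> \<Gamma> i"
    proof (cases "a \<bullet> x i > s")
      case True
      then show ?thesis using s xC t by (intro s(2) cone) (auto simp: t_def)
    qed (simp add: t_def x)
    then show ?thesis unfolding y_def using rC d D0 by (intro \<Gamma>_add cone) auto
  qed
  moreover have "a \<bullet> y i \<le> s" for i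
  proof -
    have "d i * ((a \<bullet> r) / D) \<le> d i * 1"
      using d arD D0 by (intro mult_left_mono) (auto simp: divide_le_eq)
    then show ?thesis by (simp add: y_def inner_add_right d_def)
  qed
  ultimately have "(\<Sum>i\<in>UNIV. l i *\<^sub>R y i) \<in> minkowski_comb l (\<lambda>i. \<Gamma> i \<inter> {x. a \<bullet> x \<le> s})"
    by (intro minkowski_combI) auto
  moreover have "(\<Sum>i\<in>UNIV. l i *\<^sub>R y i) = z"
  proof -
    have "(\<Sum>i\<in>UNIV. l i *\<^sub>R y i) = (\<Sum>i\<in>UNIV. (l i * t i) *\<^sub>R x i) + (\<Sum>i\<in>UNIV. (l i * d i / D) *\<^sub>R r)"
      by (simp add: y_def scaleR_right_distrib sum.distrib)
    also have "(\<Sum>i\<in>UNIV. (l i * d i / D) *\<^sub>R r) = (D / D) *\<^sub>R r"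
      by (simp only: scaleR_sum_left[symmetric] sum_divide_distrib[symmetric] D_def[symmetric])
    also have "\<dots> = r" by (rule rD)
    also have "(\<Sum>i\<in>UNIV. (l i * t i) *\<^sub>R x i) + r = z"
      unfolding r_def z sum.distrib[symmetric] scaleR_left_distrib[symmetric] by (simp add: algebra_simps)
    finally show ?thesis .
  qed
  ultimately show "z \<in> minkowski_comb l (\<lambda>i. \<Gamma> i \<inter> {x. a \<bullet> x \<le> s})" by simp
qed

section \<open>Covolume as a difference of two forms\<close>

theorem theorem10p4:
  fixes C :: "(real^'n) set" and \<Gamma> :: "'n \<Rightarrow> (real^'n) set"
  assumes "closed C" and "strictly_convex_cone C" and "aff_dim C = int CARD('n)"
    and "\<And>i. C_convex_region C (\<Gamma> i)" and "\<And>i. cobounded C (\<Gamma> i)"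
  shows "\<exists>c :: ('n \<Rightarrow> nat) \<Rightarrow> real. \<forall>l :: 'n \<Rightarrow> real. (\<forall>i. l i > 0) \<longrightarrow>
           covol C (minkowski_comb l \<Gamma>) =
           (\<Sum>\<alpha>\<in>{\<alpha>::'n \<Rightarrow> nat. (\<Sum>i\<in>UNIV. \<alpha> i) = CARD('n)}. c \<alpha> * (\<Prod>i\<in>UNIV. l i ^ \<alpha> i))"
proof -
  have cone: "\<And>x c. x \<in> C \<Longrightarrow> 0 \<le> c \<Longrightarrow> c *\<^sub>R x \<in> C" and cvx: "convex C"
    using assms(2) unfolding strictly_convex_cone_def cone_def by blast+
  have \<Gamma>C: "\<Gamma> i \<subseteq> C" and \<Gamma>cl: "closed (\<Gamma> i)" and \<Gamma>cvx: "convex (\<Gamma> i)" for i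
    using assms(4)[of i] unfolding C_convex_region_def by blast+
  \<comment> \<open>Full affine dimension identifies the interior with the relative interior, which
    is nonempty for a nonempty convex set.\<close>
  have intC: "interior C \<noteq> {}"
    using assms(3) cvx interior_rel_interior_gen[of C] rel_interior_eq_empty[of C] aff_dim_empty[of C] by auto
  obtain a b where ab: "b > 0" "\<And>x. x \<in> C \<Longrightarrow> b * norm x \<le> a \<bullet> x"
    using pointed_cone_functional[OF assms(1,2)] by blast
  define \<Delta> where "\<Delta> u = C \<inter> {x. a \<bullet> x \<le> u}" for u
  have \<Delta>_bdd: "bounded (\<Delta> u)" for u
  proof (rule boundedI)
    fix x assume "x \<in> \<Delta> u"
    then have "b * norm x \<le> u" using ab(2)[of x] by (auto simp: \<Delta>_def)
    then show "norm x \<le> u / b" using ab(1) by (simp add: field_simps)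
  qed
  have \<Delta>_cvx: "convex (\<Delta> u)" for u
    unfolding \<Delta>_def using cvx by (intro convex_Int convex_halfspace_le)
  have \<Delta>_meas: "\<Delta> u \<in> lmeasurable" for u
    using \<Delta>_cvx \<Delta>_bdd by (rule measurable_convex)

  have "\<exists>B. \<forall>x\<in>C - \<Gamma> i. norm x \<le> B" for i
    using assms(5)[of i] unfolding cobounded_def bounded_iff by blast
  then obtain B where B: "\<And>i x. x \<in> C \<Longrightarrow> x \<notin> \<Gamma> i \<Longrightarrow> norm x \<le> B i"
    by (metis DiffI)
  \<comment> \<open>The sum dominates the bound belonging to each single \<open>i\<close>, so above
    level \<open>t\<close> the cone is contained in all the regions at once.\<close>
  define t where "t = 1 + (\<Sum>i\<in>UNIV. norm a * \<bar>B i\<bar>)"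
  have t: "t > 0" unfolding t_def by (intro add_pos_nonneg sum_nonneg) auto
  have t\<Gamma>: "x \<in> \<Gamma> i" if "x \<in> C" "t \<le> a \<bullet> x" for x i
  proof (rule ccontr)
    assume "x \<notin> \<Gamma> i"
    then have "a \<bullet> x \<le> norm a * \<bar>B i\<bar>"
      using B[OF that(1)] by (intro order_trans[OF norm_cauchy_schwarz] mult_left_mono) force+
    also have "\<dots> \<le> (\<Sum>i\<in>UNIV. norm a * \<bar>B i\<bar>)" by (intro member_le_sum) auto
    finally show False using that(2) by (simp add: t_def)
  qed
  \<comment> \<open>The slab of \<open>C\<close> between the levels \<open>t\<close> and
    \<open>s\<close> belongs to every \<open>K i\<close>; this is what gives \<open>K i\<close>
    nonempty interior.\<close>
  define s where "s = t + 1"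
  have s: "s > 0" and s\<Gamma>: "\<And>i x. x \<in> C \<Longrightarrow> s \<le> a \<bullet> x \<Longrightarrow> x \<in> \<Gamma> i"
    using t t\<Gamma> by (auto simp: s_def)

  define K where "K i = \<Gamma> i \<inter> {x. a \<bullet> x \<le> s}" for i
  have K_sub: "K i \<subseteq> \<Delta> s" for i using \<Gamma>C by (auto simp: K_def \<Delta>_def)
  have K_bdd: "bounded (K i)" for i using K_sub \<Delta>_bdd bounded_subset by blast
  have K_cvx: "convex (K i)" for i unfolding K_def by (intro convex_Int \<Gamma>cvx convex_halfspace_le)
  have K_cpt: "compact (K i)" for i
    using K_bdd[of i] unfolding K_def compact_eq_bounded_closed
    by (intro conjI closed_Int \<Gamma>cl closed_halfspace_le)
  have K_int: "interior (K i) \<noteq> {}" for i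
  proof -
    have "interior C \<noteq> {0}"
      using not_open_singleton[of "0::real^'n"] open_interior[of C] by metis
    then obtain z where z: "z \<in> interior C" "z \<noteq> 0" using intC by blast
    then have az: "a \<bullet> z > 0"
      using ab(1) z(2) by (intro less_le_trans[OF _ ab(2)] subsetD[OF interior_subset z(1)]) simp
    \<comment> \<open>Moves \<open>z\<close> to level \<open>t + 1/2\<close>, the middle of the
      slab.\<close>
    define k where "k = (t + 1/2) / (a \<bullet> z)"
    have k: "k > 0" using az t by (simp add: k_def)
    have "(*\<^sub>R) k ` interior C \<subseteq> C" using k cone interior_subset[of C] by (auto simp: less_imp_le subset_iff)
    moreover have "open ((*\<^sub>R) k ` interior C)" using k by (intro open_scaling) auto
    ultimately have "(*\<^sub>R) k ` interior C \<inter> {x. a \<bullet> x > t} \<inter> {x. a \<bullet> x < s} \<subseteq> interior (K i)"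
      using t\<Gamma> by (intro interior_maximal open_Int open_halfspace_gt open_halfspace_lt) (auto simp: K_def)
    moreover have "k *\<^sub>R z \<in> (*\<^sub>R) k ` interior C \<inter> {x. a \<bullet> x > t} \<inter> {x. a \<bullet> x < s}"
      using imageI[OF z(1), of "(*\<^sub>R) k"] az by (simp add: k_def s_def)
    ultimately show ?thesis by blast
  qed
  obtain V where V: "homogeneous_form CARD('n) V"
    "\<forall>l. (\<forall>i. l i > 0) \<longrightarrow> measure lebesgue (minkowski_comb l K) = V l"
    by (rule minkowski_volume[OF K_cpt K_cvx K_int])

  have "covol C (minkowski_comb l \<Gamma>) = measure lebesgue (\<Delta> s) * (\<Sum>i\<in>UNIV. l i * 1) ^ CARD('n) - V l"
    if l: "\<And>i. l i > 0" for l
  proof -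
    define \<Lambda> where "\<Lambda> = (\<Sum>i\<in>UNIV. l i)"
    have \<Lambda>: "\<Lambda> > 0" unfolding \<Lambda>_def using l by (intro sum_pos) auto
    have trunc: "minkowski_comb l \<Gamma> \<inter> {x. a \<bullet> x \<le> s * \<Lambda>} = minkowski_comb l K"
      unfolding \<Lambda>_def K_def by (rule minkowski_comb_truncate[OF assms(2) ab assms(4) s s\<Gamma> l])
    \<comment> \<open>Such an \<open>x\<close> is the combination of \<open>CARD('n)\<close> copies
      of \<open>x / \<Lambda>\<close>, which lies above level \<open>s\<close> and hence in every
      region.\<close>
    have above: "x \<in> minkowski_comb l \<Gamma>" if "x \<in> C" "s * \<Lambda> < a \<bullet> x" for x
    proof -
      have "(1 / \<Lambda>) *\<^sub>R x \<in> \<Gamma> i" for i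
        using that \<Lambda> by (intro s\<Gamma> cone) (auto simp: field_simps)
      then have "(\<Sum>i\<in>UNIV. l i *\<^sub>R (1 / \<Lambda>) *\<^sub>R x) \<in> minkowski_comb l \<Gamma>"
        by (intro minkowski_combI)
      also have "(\<Sum>i\<in>UNIV. l i *\<^sub>R (1 / \<Lambda>) *\<^sub>R x) = \<Lambda> *\<^sub>R (1 / \<Lambda>) *\<^sub>R x"
        unfolding \<Lambda>_def by (rule scaleR_sum_left[symmetric])
      finally show ?thesis using \<Lambda> by simp
    qed
    have sub: "minkowski_comb l K \<subseteq> \<Delta> (s * \<Lambda>)"
    proof
      fix z assume z: "z \<in> minkowski_comb l K"
      then obtain x where zx: "z = (\<Sum>i\<in>UNIV. l i *\<^sub>R x i)" and x: "\<forall>i. x i \<in> K i"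
        by (rule minkowski_combE)
      have "z \<in> C"
        unfolding zx using x K_sub l intC
        by (intro sum_mem_cone[OF assms(2)] cone) (auto simp: \<Delta>_def less_imp_le)
      then show "z \<in> \<Delta> (s * \<Lambda>)" using z trunc by (auto simp: \<Delta>_def)
    qed
    have "C - minkowski_comb l \<Gamma> = \<Delta> (s * \<Lambda>) - minkowski_comb l K"
      using above trunc by (force simp: \<Delta>_def)
    moreover have "minkowski_comb l K \<in> lmeasurable"
      by (intro measurable_convex convex_minkowski_comb bounded_minkowski_comb K_cvx K_bdd)
    ultimately have "covol C (minkowski_comb l \<Gamma>) = measure lebesgue (\<Delta> (s * \<Lambda>)) - V l"
      using sub \<Delta>_meas V(2) l by (simp add: covol_def measurable_measure_Diff[OF \<Delta>_meas fmeasurableD])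
    \<comment> \<open>Truncations of a cone are dilates of each other, so the first volume is a
      constant times \<open>\<Lambda> ^ CARD('n)\<close>.\<close>
    also have "\<Delta> (s * \<Lambda>) = (*\<^sub>R) \<Lambda> ` \<Delta> s"
    proof (intro equalityI subsetI)
      fix x assume "x \<in> \<Delta> (s * \<Lambda>)"
      then have "(1 / \<Lambda>) *\<^sub>R x \<in> \<Delta> s" using \<Lambda> cone[of x "1 / \<Lambda>"] by (auto simp: \<Delta>_def field_simps)
      then show "x \<in> (*\<^sub>R) \<Lambda> ` \<Delta> s" using \<Lambda> by (intro image_eqI[of _ _ "(1 / \<Lambda>) *\<^sub>R x"]) auto
    qed (use \<Lambda> in \<open>auto simp: \<Delta>_def cone mult.commute\<close>)
    also have "measure lebesgue \<dots> = \<Lambda> ^ CARD('n) * measure lebesgue (\<Delta> s)"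
      using measure_lebesgue_affine[of \<Lambda> 0 "\<Delta> s"] \<Lambda> by simp
    finally show ?thesis by (simp add: \<Lambda>_def mult.commute)
  qed
  moreover have "homogeneous_form CARD('n)
      (\<lambda>l. measure lebesgue (\<Delta> s) * (\<Sum>i\<in>UNIV. l i * 1) ^ CARD('n) - V l)"
    by (intro homogeneous_form_diff homogeneous_form_cmult homogeneous_form_power homogeneous_form_linear V)
  ultimately show ?thesis
    unfolding homogeneous_form_def by auto
qed

end
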